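(* Let $m>0$ be an integer with $m\equiv 3$ or $5\pmod 8$. Then the graph $G_{2,m,2}$ has only one diagonal, and thus $G_{2,m,2}$ has no (directed) Hamiltonian cycle.
   Context: For positive integers $n,m$, the graph $G_{n,m,2}$ (an augmented directed grid graph on a two-holed torus) is defined as follows. Its vertices are the $4nm$ cells $(i,c)$ of a grid with $2n$ rows $0\le i<2n$ (row $0$ on top) and $2m$ columns $0\le c<2m$ (column $0$ leftmost). The bijection $u$ ("up") on cells is $u(i,c)=(i-1,c)$ if $i\ge 1$, and $u(0,c)=(2n-1,(c+m)\bmod 2m)$. The bijection $r$ ("right") on cells is $r(i,c)=(i,c+1)$ if $c<2m-1$, and $r(i,2m-1)=((i+n)\bmod 2n,0)$. The directed edges are $(\alpha,u\alpha)$ and $(\alpha,r\alpha)$ for every cell $\alpha$. A diagonal is a set $\{\alpha,u^{-1}r\alpha,(u^{-1}r)^2\alpha,\dots\}$ for a cell $\alpha$, i.e. an orbit of the permutation $u^{-1}r$ (apply $r$ first, then $u^{-1}$) on cells. A Hamiltonian cycle is a directed cycle visiting every vertex exactly once. *)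

theory Defs
  imports "Graph_Theory.Graph_Theory" "HOL-Number_Theory.Cong"
begin

section \<open>The augmented directed grid graph on the two-holed torus\<close>

type_synonym cell = "nat \<times> nat"

definition cells :: "nat \<Rightarrow> nat \<Rightarrow> cell set" where
  "cells n m = {(i, c). i < 2 * n \<and> c < 2 * m}"

fun up :: "nat \<Rightarrow> nat \<Rightarrow> cell \<Rightarrow> cell" where
  "up n m (i, c) = (if i \<ge> 1 then (i - 1, c) else (2 * n - 1, (c + m) mod (2 * m)))"

fun right :: "nat \<Rightarrow> nat \<Rightarrow> cell \<Rightarrow> cell" where
  "right n m (i, c) = (if c < 2 * m - 1 then (i, c + 1) else ((i + n) mod (2 * n), 0))"

text \<open>Only the values on \<open>cells n m\<close> are meaningful. There, both maps are bijections,
  so that \<^term>\<open>inv_into (cells n m) (up n m)\<close> really is the inverse of \<open>up\<close>.\<close>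

lemma finite_cells: "finite (cells n m)"
proof -
  have "cells n m = {..<2 * n} \<times> {..<2 * m}"
    by (auto simp: cells_def)
  then show ?thesis by simp
qed

lemma card_cells: "card (cells n m) = 4 * n * m"
proof -
  have "cells n m = {..<2 * n} \<times> {..<2 * m}"
    by (auto simp: cells_def)
  then show ?thesis by (simp add: card_cartesian_product)
qed

lemma half_shift:
  fixes a k :: nat
  assumes "a < 2 * k"
  shows "(a + k) mod (2 * k) = (if a < k then a + k else a - k)"
proof (cases "a < k")
  case False
  then have "(a + k) mod (2 * k) = (a - k) mod (2 * k)"
    using assms by (simp add: le_mod_geq)
  then show ?thesis using False assms by simp
qed (use assms in simp)

lemma bij_betw_up:
  assumes "n > 0" "m > 0"
  shows "bij_betw (up n m) (cells n m) (cells n m)"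
proof -
  have into: "up n m ` cells n m \<subseteq> cells n m"
    using assms by (auto simp: cells_def split: if_splits)
  have "inj_on (up n m) (cells n m)"
    by (auto simp: inj_on_def cells_def half_shift split: if_splits)
  then show ?thesis
    using into endo_inj_surj[OF finite_cells] by (auto simp: bij_betw_def)
qed

lemma bij_betw_right:
  assumes "n > 0" "m > 0"
  shows "bij_betw (right n m) (cells n m) (cells n m)"
proof -
  have into: "right n m ` cells n m \<subseteq> cells n m"
    using assms by (auto simp: cells_def split: if_splits)
  have "inj_on (right n m) (cells n m)"
    by (auto simp: inj_on_def cells_def half_shift split: if_splits)
  then show ?thesis
    using into endo_inj_surj[OF finite_cells] by (auto simp: bij_betw_def)
qed

definition grid_graph :: "nat \<Rightarrow> nat \<Rightarrow> cell pair_pre_digraph" where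
  "grid_graph n m =
    \<lparr> pverts = cells n m,
      parcs = {(a, up n m a) | a. a \<in> cells n m} \<union> {(a, right n m a) | a. a \<in> cells n m} \<rparr>"

lemma pair_fin_digraph_grid_graph:
  assumes "n > 0" "m > 0"
  shows "pair_fin_digraph (grid_graph n m)"
proof
  show "fst e \<in> pverts (grid_graph n m)" "snd e \<in> pverts (grid_graph n m)"
    if "e \<in> parcs (grid_graph n m)" for e
    using that bij_betwE[OF bij_betw_up[OF assms]] bij_betwE[OF bij_betw_right[OF assms]]
    by (auto simp: grid_graph_def)
  have "parcs (grid_graph n m) =
      (\<lambda>a. (a, up n m a)) ` cells n m \<union> (\<lambda>a. (a, right n m a)) ` cells n m"
    by (auto simp only: grid_graph_def pair_pre_digraph.simps)
  then show "finite (parcs (grid_graph n m))"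
    by (simp add: finite_cells)
  show "finite (pverts (grid_graph n m))"
    by (simp add: grid_graph_def finite_cells)
qed

section \<open>Diagonals and Hamiltonian cycles\<close>

definition diagonal :: "nat \<Rightarrow> nat \<Rightarrow> cell \<Rightarrow> cell set" where
  "diagonal n m a = {((inv_into (cells n m) (up n m) \<circ> right n m) ^^ k) a | k. True}"

definition diagonals :: "nat \<Rightarrow> nat \<Rightarrow> cell set set" where
  "diagonals n m = diagonal n m ` cells n m"

text \<open>\<^const>\<open>pre_digraph.cycle\<close> already demands that the vertices of the closed directed
  walk are pairwise distinct, apart from the start being repeated at the end.\<close>

definition hamiltonian_cycle :: "('a, 'b) pre_digraph \<Rightarrow> 'b list \<Rightarrow> bool" where
  "hamiltonian_cycle G p \<longleftrightarrow>
    pre_digraph.cycle G p \<and>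
    (\<exists>v. pre_digraph.awalk G v p v \<and> set (pre_digraph.awalk_verts G v p) = verts G)"

end

(* In G_{2,m,2} a diagonal step moves one row down, or one row up when it crosses the right
   seam, so the diagonal permutation is governed by its first return map to row 0. Modulo 2m
   this map is the translation by m + 4, followed by the two transpositions exchanging m with m
   + 2 and m + 1 with m + 3. For odd m the translation is a single 2m-cycle; if l(m + 4) is 1 or
   -1 modulo 2m, the four exchanged residues occupy the positions 0, l, 2l, 3l along it. For m =
   3 or 5 modulo 8 there is such an l with 3l < 2m, so the two transpositions interlace and the
   product is again a single cycle.

   The cells from which a Hamiltonian cycle leaves to the right form a union of diagonals: if it
   goes from a to ra, it cannot also enter ra from the cell below, which is the successor of a
   on the diagonal, so it leaves that cell to the right as well. With a single diagonal it
   therefore moves always up or always right, which preserves the column modulo m or the row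
   modulo n. *)

theory Submission
  imports Defs
begin

section \<open>A cyclic progression with two interlacing swaps\<close>

text \<open>The exchanges cut the progression \<open>e, e + t, e + 2t, \<dots>\<close> into four arcs starting at the
  positions \<open>0, l, 2l, 3l\<close> and glue them together again in another order. For a predicate
  this makes the cycle structure unnecessary: it is enough that the arcs are connected.\<close>

lemma swapped_progression:
  fixes Q :: "int \<Rightarrow> bool" and M t l e x :: int
  assumes periodic: "\<And>x y. [x = y] (mod M) \<Longrightarrow> Q x = Q y"
    and coprime: "coprime t M" and l: "0 < l" "3 * l < M"
    and step: "\<And>y. \<not> [y = e] (mod M) \<Longrightarrow> \<not> [y = e + l * t] (mod M) \<Longrightarrow>
      \<not> [y = e + 2 * l * t] (mod M) \<Longrightarrow> \<not> [y = e + 3 * l * t] (mod M) \<Longrightarrow> Q (y - t) = Q y"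
    and swap: "Q (e - t) = Q (e + 2 * l * t)" "Q (e + l * t - t) = Q (e + 3 * l * t)"
      "Q (e + 2 * l * t - t) = Q e" "Q (e + 3 * l * t - t) = Q (e + l * t)"
  shows "Q x = Q e"
proof -
  \<comment> \<open>\<open>P k\<close> is the value at position \<open>k\<close> of the progression.
    As \<open>t\<close> is coprime to \<open>M\<close>, the positions \<open>0\<close> to
    \<open>M - 1\<close> meet each residue once.\<close>
  define P where "P k = Q (e + k * t)" for k
  have inj: "k = k'" if "[e + k * t = e + k' * t] (mod M)" "0 \<le> k" "k < M" "0 \<le> k'" "k' < M" for k k'
  proof -
    have "[k * t = k' * t] (mod M)"
      using that(1) by (simp add: cong_add_lcancel)
    then have "[k = k'] (mod M)"
      using coprime by (simp add: cong_mult_rcancel)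
    then show ?thesis using that by (simp add: cong_less_imp_eq_int)
  qed
  have P_step: "P (k - 1) = P k" if "0 < k" "k < M" "k \<noteq> l" "k \<noteq> 2 * l" "k \<noteq> 3 * l" for k
  proof -
    have "Q (e + k * t - t) = Q (e + k * t)"
      using inj[of k 0] inj[of k l] inj[of k "2 * l"] inj[of k "3 * l"] that l
      by (intro step) auto
    then show ?thesis by (simp add: P_def algebra_simps)
  qed
  \<comment> \<open>The three disjunctions keep the cut positions \<open>l\<close>,
    \<open>2 * l\<close>, \<open>3 * l\<close> from lying strictly between \<open>a\<close> and
    \<open>b\<close>.\<close>
  have arc: "P k = P a"
    if "a \<le> k" "k < b" "0 \<le> a" "b \<le> M" "l \<le> a \<or> b \<le> l" "2 * l \<le> a \<or> b \<le> 2 * l"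
      "3 * l \<le> a \<or> b \<le> 3 * l" for a b k
    using that
  proof (induction k rule: int_ge_induct)
    case (step k)
    then show ?case using P_step[of "k + 1"] by auto
  qed simp
  have arcs: "P k = P 0" if "0 \<le> k" "k < l" for k using arc[of 0 k l] that l by auto
  have arcs1: "P k = P l" if "l \<le> k" "k < 2 * l" for k using arc[of l k "2 * l"] that l by auto
  have arcs2: "P k = P (2 * l)" if "2 * l \<le> k" "k < 3 * l" for k
    using arc[of "2 * l" k "3 * l"] that l by auto
  have arcs3: "P k = P (3 * l)" if "3 * l \<le> k" "k < M" for k
    using arc[of "3 * l" k M] that l by auto
  \<comment> \<open>Cyclically, position \<open>M - 1\<close> precedes position \<open>0\<close>, so
    the swap at \<open>e\<close> decides where the last arc leads.\<close>
  have "[e + (M - 1) * t = e - t] (mod M)"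
    by (auto simp: cong_iff_dvd_diff algebra_simps)
  then have "P (M - 1) = P (2 * l)"
    using swap(1) periodic by (simp add: P_def)
  then have eq32: "P (3 * l) = P (2 * l)" using arcs3[of "M - 1"] l by auto
  \<comment> \<open>Number the arcs 0 to 3 by their starts. Arc 3 leads to arc 2 by the previous
    step; here arc 0 leads to arc 3 and arc 1 to arc 0, which connects all four.\<close>
  have "P (l - 1) = P (3 * l)" "P (2 * l - 1) = P 0"
    using swap by (simp_all add: P_def algebra_simps)
  then have eqs: "P 0 = P (3 * l)" "P l = P 0"
    using arcs[of "l - 1"] arcs1[of "2 * l - 1"] l by auto
  have const: "P k = P 0" if "0 \<le> k" "k < M" for k
    using arcs[of k] arcs1[of k] arcs2[of k] arcs3[of k] that eq32 eqs
    by (cases "k < l"; cases "k < 2 * l"; cases "k < 3 * l") auto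
  \<comment> \<open>Inverting \<open>t\<close> locates \<open>x\<close>: its position is
    \<open>i * (x - e)\<close> reduced modulo \<open>M\<close>.\<close>
  obtain i where i: "[t * i = 1] (mod M)"
    using cong_solve_coprime_int[OF coprime] by blast
  define k where "k = (i * (x - e)) mod M"
  have "[e + k * t = e + i * (x - e) * t] (mod M)"
    unfolding k_def by (intro cong_add cong_mult cong_refl) simp
  also have "[e + i * (x - e) * t = e + 1 * (x - e)] (mod M)"
    using cong_add[OF cong_refl[of e] cong_mult[OF i cong_refl[of "x - e"]]] by (simp add: ac_simps)
  finally have "Q x = P k"
    using periodic unfolding P_def by (metis add.commute cong_sym diff_add_cancel mult_1)
  moreover have "0 \<le> k" "k < M" using l by (simp_all add: k_def)
  ultimately show ?thesis using const[of k] by (simp add: P_def)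
qed

section \<open>Diagonals as orbits of a permutation\<close>

definition diag_step :: "nat \<Rightarrow> nat \<Rightarrow> cell \<Rightarrow> cell" where
  "diag_step n m = inv_into (cells n m) (up n m) \<circ> right n m"

lemma diagonal_eq: "diagonal n m a = {(diag_step n m ^^ k) a | k. True}"
  by (simp add: diagonal_def diag_step_def)

lemma bij_betw_diag_step:
  assumes "n > 0" "m > 0"
  shows "bij_betw (diag_step n m) (cells n m) (cells n m)"
  unfolding diag_step_def
  using bij_betw_trans[OF bij_betw_right bij_betw_inv_into[OF bij_betw_up]] assms by blast

lemma up_diag_step:
  assumes "n > 0" "m > 0" "a \<in> cells n m"
  shows "up n m (diag_step n m a) = right n m a"
  using bij_betw_inv_into_right[OF bij_betw_up] bij_betwE[OF bij_betw_right] assms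
  by (auto simp: diag_step_def)

text \<open>Lets a step be found by checking a candidate \<open>b\<close>, without evaluating
  \<open>inv_into\<close>.\<close>

lemma diag_step_eqI:
  assumes "n > 0" "m > 0" "b \<in> cells n m" "up n m b = right n m a"
  shows "diag_step n m a = b"
  using bij_betw_inv_into_left[OF bij_betw_up] assms by (metis comp_apply diag_step_def)

lemma diagonal_subset:
  assumes "diag_step n m ` S \<subseteq> S" "a \<in> S"
  shows "diagonal n m a \<subseteq> S"
proof -
  have "(diag_step n m ^^ k) a \<in> S" for k
    using assms by (induction k) auto
  then show ?thesis by (auto simp: diagonal_eq)
qed

text \<open>An orbit is itself invariant, so applying \<open>const\<close> to membership in it shows
  that it fills the grid. Having one orbit is thereby reduced to invariant predicates, and no orbit
  length has to be computed.\<close>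

lemma diagonals_eq_singleton:
  fixes n m :: nat
  assumes "n > 0" "m > 0"
    and const: "\<And>(P :: cell \<Rightarrow> bool) a b. (\<And>x. x \<in> cells n m \<Longrightarrow> P (diag_step n m x) = P x) \<Longrightarrow>
      a \<in> cells n m \<Longrightarrow> b \<in> cells n m \<Longrightarrow> P a = P b"
  shows "diagonals n m = {cells n m}"
proof -
  have "diagonal n m a = cells n m" if a: "a \<in> cells n m" for a
  proof -
    let ?D = "diagonal n m a"
    note bij = bij_betw_diag_step[OF assms(1,2)]
    have sub: "?D \<subseteq> cells n m"
      using diagonal_subset[of n m "cells n m"] bij_betw_imp_surj_on[OF bij] a by blast
    have "a = (diag_step n m ^^ 0) a" by simp
    then have a_in: "a \<in> ?D" unfolding diagonal_eq by blast
    have closed: "diag_step n m ` ?D \<subseteq> ?D"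
    proof
      fix y assume "y \<in> diag_step n m ` ?D"
      then obtain k where "y = (diag_step n m ^^ Suc k) a" by (auto simp: diagonal_eq)
      then show "y \<in> ?D" unfolding diagonal_eq by blast
    qed
    have inj: "inj_on (diag_step n m) (cells n m)" using bij by (rule bij_betw_imp_inj_on)
    \<comment> \<open>On a finite set an injective self-map is onto; this makes membership pass
      backwards along a step too.\<close>
    have image: "diag_step n m ` ?D = ?D"
      using closed inj_on_subset[OF inj sub] finite_subset[OF sub finite_cells]
      by (intro endo_inj_surj)
    have "(diag_step n m x \<in> ?D) = (x \<in> ?D)" if "x \<in> cells n m" for x
      using image inj_on_image_mem_iff[OF inj that sub] by blast
    from const[of "\<lambda>x. x \<in> ?D", OF this a] a_in sub show ?thesis by blast
  qed
  then have "diagonals n m = (\<lambda>_. cells n m) ` cells n m"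
    unfolding diagonals_def by (intro image_cong) auto
  moreover have "(0, 0) \<in> cells n m" using assms(1,2) by (simp add: cells_def)
  ultimately show ?thesis by (auto simp: image_constant)
qed

section \<open>Hamiltonian cycles in the presence of a single diagonal\<close>

lemma (in pre_digraph) cas_invariant:
  assumes "cas u p v" "\<And>e. e \<in> set p \<Longrightarrow> h (head G e) = h (tail G e)" "w \<in> set (awalk_verts u p)"
  shows "h w = h u"
  using assms by (induction u p v rule: cas.induct) auto

text \<open>Counting arcs at a vertex needs the heads and tails of \<open>p\<close> rather than its
  vertex sequence, which repeats \<open>v\<close>.\<close>

lemma hamiltonian_cycleE:
  assumes "hamiltonian_cycle G p"
  obtains v where "pre_digraph.awalk G v p v" "set (pre_digraph.awalk_verts G v p) = verts G"
    "distinct (map (head G) p)" "set (map (head G) p) = verts G" "set (map (tail G) p) = verts G"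
proof -
  interpret pre_digraph G .
  obtain u v where u: "distinct (tl (awalk_verts u p))" "p \<noteq> []"
    and v: "awalk v p v" "set (awalk_verts v p) = verts G"
    using assms by (auto simp: hamiltonian_cycle_def cycle_def)
  have cas: "cas v p v" using v by (simp add: awalk_def)
  \<comment> \<open>The vertex sequence is the list of heads with \<open>v\<close> put in front, or
    the list of tails with \<open>v\<close> appended. As \<open>v\<close> is also a head and a tail,
    neither list misses a vertex.\<close>
  have heads: "awalk_verts v p = tail G (hd p) # map (head G) p"
    and tails: "awalk_verts v p = map (tail G) p @ [head G (last p)]"
    using u awalk_verts_conv[of v p] awalk_verts_conv'[OF cas] by auto
  have hd: "tail G (hd p) = v" using cas u cas_simp by blast
  have "head G (last p) = v"
  proof -
    have "last (awalk_verts v q) = w" if "cas v q w" for v q w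
      using that by (induction v q w rule: cas.induct) auto
    from this[OF cas] show ?thesis using tails by simp
  qed
  with hd have mem: "v \<in> tail G ` set p" "v \<in> head G ` set p"
    using u(2) by (metis hd_in_set imageI, metis last_in_set imageI)
  show ?thesis
  proof (rule that[OF v])
    \<comment> \<open>The start \<open>u\<close> from \<open>cycle\<close> may be replaced by
      \<open>v\<close>: for nonempty \<open>p\<close> the vertex sequence does not depend on
      it.\<close>
    show "distinct (map (head G) p)"
      using u awalk_verts_ne_eq[of p u v] heads by simp
    show "set (map (head G) p) = verts G"
      using heads v(2) mem(2) hd by (simp add: insert_absorb)
    show "set (map (tail G) p) = verts G"
      using tails v(2) mem(1) \<open>head G (last p) = v\<close> by (simp add: insert_absorb)
  qed
qed

lemma up_column_mod:
  assumes "a \<in> cells n m"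
  shows "snd (up n m a) mod m = snd a mod m"
  using assms by (cases a) (auto simp: mod_mod_cancel)

lemma right_row_mod:
  assumes "a \<in> cells n m"
  shows "fst (right n m a) mod n = fst a mod n"
  using assms by (cases a) (auto simp: mod_mod_cancel)

lemma arc_cases:
  assumes "e \<in> parcs (grid_graph n m)"
  shows "fst e \<in> cells n m" "snd e = up n m (fst e) \<or> snd e = right n m (fst e)"
  using assms by (auto simp: grid_graph_def)

lemma no_hamiltonian_cycle_if_single_diagonal:
  assumes n: "n > 1" and m: "m > 1" and single: "diagonals n m = {cells n m}"
  shows "\<not> hamiltonian_cycle (with_proj (grid_graph n m)) p"
proof
  interpret pre_digraph "with_proj (grid_graph n m)" .
  assume "hamiltonian_cycle (with_proj (grid_graph n m)) p"
  then obtain v where "pre_digraph.awalk (with_proj (grid_graph n m)) v p v"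
      "set (pre_digraph.awalk_verts (with_proj (grid_graph n m)) v p) = pverts (grid_graph n m)"
      "distinct (map snd p)" "set (map snd p) = pverts (grid_graph n m)"
      "set (map fst p) = pverts (grid_graph n m)"
    by (rule hamiltonian_cycleE) simp
  then have walk: "awalk v p v" "set (awalk_verts v p) = cells n m"
    and heads: "distinct (map snd p)" "set (map snd p) = cells n m"
    and tails: "set (map fst p) = cells n m"
    by (simp_all add: grid_graph_def)
  have cas: "cas v p v" and arcs: "set p \<subseteq> parcs (grid_graph n m)"
    using walk by (auto simp: awalk_def)
  define S where "S = {a \<in> cells n m. (a, right n m a) \<in> set p}"
  have closed: "diag_step n m ` S \<subseteq> S"
  proof
    fix b assume "b \<in> diag_step n m ` S"
    then obtain a where a: "a \<in> cells n m" "(a, right n m a) \<in> set p" "b = diag_step n m a"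
      by (auto simp: S_def)
    have b: "b \<in> cells n m" "up n m b = right n m a"
      using a bij_betwE[OF bij_betw_diag_step[of n m]] up_diag_step[of n m a] n m by auto
    then have "b \<in> fst ` set p" using tails by simp
    then obtain e where e: "e \<in> set p" "fst e = b" by blast
    then have "e = (b, up n m b) \<or> e = (b, right n m b)"
      using arcs arc_cases[of e n m] by (metis prod.collapse subsetD)
    then have "(b, right n m b) \<in> set p"
    proof
      assume "e = (b, up n m b)"
      \<comment> \<open>Both arcs of \<open>p\<close> end in \<open>right n m a\<close>, so they
        coincide. This gives \<open>b = a\<close>, and the claim holds for \<open>a\<close>.\<close>
      then have "e = (a, right n m a)"
        using heads(1) e(1) a(2) b(2) inj_onD[of snd "set p" e "(a, right n m a)"]
        by (simp add: distinct_map)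
      then show ?thesis using e by auto
    qed (use e in auto)
    then show "b \<in> S" using b by (simp add: S_def)
  qed
  \<comment> \<open>The invariants used are a column modulo \<open>m\<close> and a row modulo
    \<open>n\<close>; both separate \<open>(0, 0)\<close> from \<open>(1, 1)\<close> since the
    moduli exceed 1.\<close>
  have no_inv: "False" if "\<And>e. e \<in> set p \<Longrightarrow> h (snd e) = h (fst e)"
      "h (0, 0) \<noteq> h (1, 1)" for h :: "cell \<Rightarrow> nat"
  proof -
    have "(0, 0) \<in> cells n m" "(1, 1) \<in> cells n m" using n m by (auto simp: cells_def)
    then show False
      using cas_invariant[OF cas, of h] walk(2) that by simp
  qed
  show False
  proof (cases "S = {}")
    case True
    have "snd (snd e) mod m = snd (fst e) mod m" if "e \<in> set p" for e
    proof -
      have "e \<in> parcs (grid_graph n m)" using arcs that by blast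
      note e = arc_cases[OF this]
      have "snd e \<noteq> right n m (fst e)"
      proof
        assume "snd e = right n m (fst e)"
        then have "fst e \<in> S"
          using that e(1) unfolding S_def by (metis (mono_tags, lifting) mem_Collect_eq prod.collapse)
        then show False using True by simp
      qed
      then have "snd e = up n m (fst e)" using e(2) by simp
      then show ?thesis using e(1) by (simp add: up_column_mod)
    qed
    then show False using no_inv[of "\<lambda>a. snd a mod m"] m by simp
  next
    case False
    then obtain a where a: "a \<in> S" by auto
    then have "a \<in> cells n m" by (simp add: S_def)
    then have "diagonal n m a = cells n m" using single unfolding diagonals_def by blast
    then have all: "S = cells n m" using diagonal_subset[OF closed a] unfolding S_def by blast
    \<comment> \<open>Distinct heads give \<open>p\<close> as many arcs as there are cells, so the
      arcs to the right already exhaust it.\<close>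
    let ?R = "(\<lambda>a. (a, right n m a)) ` cells n m"
    have "?R \<subseteq> set p" using all unfolding S_def by blast
    moreover have "card ?R = card (cells n m)" by (simp add: card_image inj_on_def)
    moreover have "card (set p) = card (cells n m)"
      using heads by (metis card_image distinct_map set_map)
    ultimately have "set p = ?R" by (metis card_subset_eq finite_set)
    then have "\<exists>a\<in>cells n m. e = (a, right n m a)" if "e \<in> set p" for e
      using that by (simp add: image_iff)
    then have "fst (snd e) mod n = fst (fst e) mod n" if "e \<in> set p" for e
      using that right_row_mod by fastforce
    then show False using no_inv[of "\<lambda>a. fst a mod n"] n by simp
  qed
qed

section \<open>The return map to row 0 on four rows\<close>

text \<open>The right seam shifts rows by two modulo four, so the step down after it nets one row
  up. From row 1 the bottom seam is crossed as well, whence column \<open>m\<close>.\<close>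

lemma diag_step_two_rows:
  assumes "m > 0"
  shows "c + 1 < 2 * m \<Longrightarrow> i < 3 \<Longrightarrow> diag_step 2 m (i, c) = (i + 1, c + 1)"
    and "c + 1 < 2 * m \<Longrightarrow> diag_step 2 m (3, c) = (0, (c + 1 + m) mod (2 * m))"
    and "diag_step 2 m (0, 2 * m - 1) = (3, 0)"
    and "diag_step 2 m (1, 2 * m - 1) = (0, m)"
    and "diag_step 2 m (2, 2 * m - 1) = (1, 0)"
    and "diag_step 2 m (3, 2 * m - 1) = (2, 0)"
proof -
  have shift: "((c + 1 + m) mod (2 * m) + m) mod (2 * m) = c + 1" if "c + 1 < 2 * m"
  proof -
    have "((c + 1 + m) mod (2 * m) + m) mod (2 * m) = (c + 1 + m + m) mod (2 * m)"
      by (rule mod_add_left_eq)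
    also have "c + 1 + m + m = c + 1 + 2 * m" by simp
    also have "(c + 1 + 2 * m) mod (2 * m) = c + 1" using that by (metis mod_add_self2 mod_less)
    finally show ?thesis .
  qed
  show "diag_step 2 m (3, c) = (0, (c + 1 + m) mod (2 * m))" if "c + 1 < 2 * m"
    using that assms shift by (intro diag_step_eqI) (simp_all add: cells_def)
  show "diag_step 2 m (i, c) = (i + 1, c + 1)" if "c + 1 < 2 * m" "i < 3"
    using that assms by (intro diag_step_eqI) (simp_all add: cells_def)
  have "(m + m) mod (2 * m) = 0" by (simp flip: mult_2)
  then show "diag_step 2 m (1, 2 * m - 1) = (0, m)"
    using assms by (intro diag_step_eqI) (simp_all add: cells_def)
  show "diag_step 2 m (0, 2 * m - 1) = (3, 0)" "diag_step 2 m (2, 2 * m - 1) = (1, 0)"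
    "diag_step 2 m (3, 2 * m - 1) = (2, 0)"
    using assms by (intro diag_step_eqI; simp add: cells_def)+
qed

text \<open>Four steps down add \<open>m + 4\<close> to the column, unless the right seam
  intervenes. From the last four columns the orbit is followed across that seam, and the images
  \<open>m\<close>, \<open>m + 1\<close>, \<open>m + 2\<close>, \<open>m + 3\<close> expected from
  the translation come out swapped in pairs at distance 2.\<close>

lemma two_rows_return:
  fixes P :: "cell \<Rightarrow> bool"
  assumes m: "m \<ge> 3" and inv: "\<And>a. a \<in> cells 2 m \<Longrightarrow> P (diag_step 2 m a) = P a"
  shows "c + 4 < 2 * m \<Longrightarrow> P (0, (c + m + 4) mod (2 * m)) = P (0, c)"
    and "P (0, (m + 2) mod (2 * m)) = P (0, 2 * m - 4)"
    and "P (0, (m + 3) mod (2 * m)) = P (0, 2 * m - 3)"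
    and "P (0, m) = P (0, 2 * m - 2)"
    and "P (0, (m + 1) mod (2 * m)) = P (0, 2 * m - 1)"
    and "i < 4 \<Longrightarrow> c < 2 * m \<Longrightarrow> \<exists>c'<2 * m. P (i, c) = P (0, c')"
proof -
  have inv': "P (diag_step 2 m (i, c)) = P (i, c)" if "i < 4" "c < 2 * m" for i c
    using that by (intro inv) (auto simp: cells_def)
  note d = diag_step_two_rows
  have down: "P (i, c) = P (i', c')" if "i' = i + 1" "c' = c + 1" "c' < 2 * m" "i < 3" for i c i' c'
    using inv'[of i c] d(1)[of m c i] that by simp
  have wrap: "P (3, c) = P (0, c')" if "c' = (c + 1 + m) mod (2 * m)" "c + 1 < 2 * m" for c c'
    using inv'[of 3 c] d(2)[of m c] that by simp
  have last: "P (0, 2 * m - 1) = P (3, 0)" "P (1, 2 * m - 1) = P (0, m)"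
    "P (2, 2 * m - 1) = P (1, 0)" "P (3, 2 * m - 1) = P (2, 0)"
    using inv'[of 0 "2 * m - 1"] inv'[of 1 "2 * m - 1"] inv'[of 2 "2 * m - 1"]
      inv'[of 3 "2 * m - 1"] d(3-6)[of m] m by simp_all
  have start: "P (2, 0) = P (3, 1)" "P (1, 0) = P (2, 1)" "P (2, 1) = P (3, 2)"
    by (intro down; use m in simp)+
  have three: "P (0, c) = P (3, c + 3)" if "c + 3 < 2 * m" for c
    using down[of 1 0 "c + 1" c] down[of 2 1 "c + 2" "c + 1"] down[of 3 2 "c + 3" "c + 2"] that
    by simp
  show "P (0, (c + m + 4) mod (2 * m)) = P (0, c)" if "c + 4 < 2 * m"
    using three[of c] wrap[of "(c + m + 4) mod (2 * m)" "c + 3"] that by (simp add: ac_simps)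
  show "P (0, (m + 2) mod (2 * m)) = P (0, 2 * m - 4)"
    using three[of "2 * m - 4"] last(4) start(1) wrap[of "(m + 2) mod (2 * m)" 1] m
    by (simp add: ac_simps)
  show "P (0, (m + 3) mod (2 * m)) = P (0, 2 * m - 3)"
  proof -
    have "P (0, 2 * m - 3) = P (1, 2 * m - 2)" "P (1, 2 * m - 2) = P (2, 2 * m - 1)"
      by (intro down; use m in simp)+
    moreover have "P (3, 2) = P (0, (m + 3) mod (2 * m))"
      using wrap[OF refl, of 2] m by (simp add: numeral_3_eq_3)
    ultimately show ?thesis using last(3) start(2,3) by simp
  qed
  show "P (0, m) = P (0, 2 * m - 2)"
  proof -
    have "P (0, 2 * m - 2) = P (1, 2 * m - 1)"
      by (intro down; use m in simp)
    then show ?thesis using last(2) by simp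
  qed
  show "P (0, (m + 1) mod (2 * m)) = P (0, 2 * m - 1)"
    using last(1) wrap[of "(m + 1) mod (2 * m)" 0] m by (simp add: ac_simps)
  \<comment> \<open>Rows are treated from the bottom up: a step leads one row down, and the last
    column is followed across the seam.\<close>
  have bottom: "\<exists>c'<2 * m. P (3, c) = P (0, c')" if "c < 2 * m" for c
  proof (cases "c + 1 < 2 * m")
    case False
    then have "c = 2 * m - 1" using that by simp
    then have "P (3, c) = P (0, (1 + 1 + m) mod (2 * m))"
      using last(4) start(1) wrap[OF refl, of 1] m by simp
    moreover have "(1 + 1 + m) mod (2 * m) < 2 * m" using m by simp
    ultimately show ?thesis by blast
  next
    case True
    moreover have "(c + 1 + m) mod (2 * m) < 2 * m" using m by simp
    ultimately show ?thesis using wrap[OF refl, of c] by blast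
  qed
  have third: "\<exists>c'<2 * m. P (2, c) = P (0, c')" if "c < 2 * m" for c
  proof (cases "c + 1 < 2 * m")
    case True
    then show ?thesis using down[of 3 2 "c + 1" c] bottom[of "c + 1"] by simp
  next
    case False
    then have "c = 2 * m - 1" using that by simp
    then show ?thesis using last(3) start(2,3) bottom[of 2] m by simp
  qed
  have second: "\<exists>c'<2 * m. P (1, c) = P (0, c')" if "c < 2 * m" for c
  proof (cases "c + 1 < 2 * m")
    case True
    then show ?thesis using down[of 2 1 "c + 1" c] third[of "c + 1"] by simp
  next
    case False
    then have "c = 2 * m - 1" using that by simp
    moreover have "m < 2 * m" using m by simp
    ultimately show ?thesis using last(2) by blast
  qed
  show "\<exists>c'<2 * m. P (i, c) = P (0, c')" if "i < 4" "c < 2 * m"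
  proof -
    have "i = 0 \<or> i = 1 \<or> i = 2 \<or> i = 3" using that(1) by auto
    then show ?thesis using that(2) bottom third second by blast
  qed
qed

text \<open>Extending row 0 periodically to the integers turns the return map into a translation of
  residues, indexed by the target \<open>y\<close>.\<close>

lemma two_rows_cyclic:
  fixes P :: "cell \<Rightarrow> bool" and m :: nat
  defines "Q \<equiv> \<lambda>x. P (0, nat (x mod (2 * int m)))"
  assumes m: "m \<ge> 3" and inv: "\<And>a. a \<in> cells 2 m \<Longrightarrow> P (diag_step 2 m a) = P a"
  shows "\<not> [y = int m] (mod 2 * int m) \<Longrightarrow> \<not> [y = int m + 1] (mod 2 * int m) \<Longrightarrow>
      \<not> [y = int m + 2] (mod 2 * int m) \<Longrightarrow> \<not> [y = int m + 3] (mod 2 * int m) \<Longrightarrow>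
      Q (y - (int m + 4)) = Q y"
    and "Q (int m - (int m + 4)) = Q (int m + 2)"
    and "Q (int m + 1 - (int m + 4)) = Q (int m + 3)"
    and "Q (int m + 2 - (int m + 4)) = Q (int m)"
    and "Q (int m + 3 - (int m + 4)) = Q (int m + 1)"
proof -
  note ret = two_rows_return[where P = P, OF m inv]
  have Q_eq: "Q x = P (0, c mod (2 * m))" if "[x = int c] (mod 2 * int m)" for x c
  proof -
    have "x mod (2 * int m) = int (c mod (2 * m))"
      using that by (simp add: cong_def zmod_int)
    then show ?thesis by (simp add: Q_def)
  qed
  \<comment> \<open>The last four columns are the residues \<open>-4\<close> to
    \<open>-1\<close>.\<close>
  have neg: "Q x = P (0, 2 * m - k)" if "x = - int k" "0 < k" "k \<le> 4" for x k
  proof -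
    have "[x = int (2 * m - k)] (mod 2 * int m)"
      using that m by (simp add: cong_iff_dvd_diff of_nat_diff)
    from Q_eq[OF this] show ?thesis using that m by simp
  qed
  have pos: "Q x = P (0, c mod (2 * m))" if "x = int c" for x c
    using that by (simp add: Q_eq)
  show "Q (int m - (int m + 4)) = Q (int m + 2)"
    using neg[of _ 4] pos[of "int m + 2" "m + 2"] ret(2) by simp
  show "Q (int m + 1 - (int m + 4)) = Q (int m + 3)"
    using neg[of _ 3] pos[of "int m + 3" "m + 3"] ret(3) by simp
  show "Q (int m + 2 - (int m + 4)) = Q (int m)"
    using neg[of _ 2] pos[of "int m" m] ret(4) m by simp
  show "Q (int m + 3 - (int m + 4)) = Q (int m + 1)"
    using neg[of _ 1] pos[of "int m + 1" "m + 1"] ret(5) by simp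
  show "Q (y - (int m + 4)) = Q y"
    if y: "\<not> [y = int m] (mod 2 * int m)" "\<not> [y = int m + 1] (mod 2 * int m)"
      "\<not> [y = int m + 2] (mod 2 * int m)" "\<not> [y = int m + 3] (mod 2 * int m)"
  proof -
    define c where "c = nat ((y - (int m + 4)) mod (2 * int m))"
    have c: "int c = (y - (int m + 4)) mod (2 * int m)" "c < 2 * m"
      using m by (auto simp: c_def nat_less_iff)
    have "[int c = y - (int m + 4)] (mod 2 * int m)" by (simp add: c)
    then have yc: "[y = int c + int m + 4] (mod 2 * int m)"
      by (simp add: cong_iff_dvd_diff algebra_simps dvd_diff_commute)
    \<comment> \<open>A source among the last four columns would have one of the four excluded
      residues as its target.\<close>
    have "c + 4 < 2 * m"
    proof (rule ccontr)
      assume "\<not> c + 4 < 2 * m"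
      then have "int c + int m + 4 = int m + 2 * int m \<or> int c + int m + 4 = int m + 1 + 2 * int m \<or>
          int c + int m + 4 = int m + 2 + 2 * int m \<or> int c + int m + 4 = int m + 3 + 2 * int m"
        using c(2) by linarith
      moreover have "[y = z + 2 * int m] (mod 2 * int m) \<longleftrightarrow> [y = z] (mod 2 * int m)" for z
        by (simp add: cong_def)
      ultimately show False using yc y by metis
    qed
    moreover have "Q y = P (0, (c + m + 4) mod (2 * m))"
      using yc by (intro Q_eq) simp
    moreover have "Q (y - (int m + 4)) = P (0, c)" by (simp add: Q_def c_def)
    ultimately show ?thesis using ret(1)[of c] by simp
  qed
qed

section \<open>The residue classes 3 and 5 modulo 8\<close>

lemma two_rows_invariant_constant:
  fixes P :: "cell \<Rightarrow> bool"
  assumes m: "[m = 3] (mod 8) \<or> [m = 5] (mod 8)"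
    and inv: "\<And>a. a \<in> cells 2 m \<Longrightarrow> P (diag_step 2 m a) = P a"
    and ab: "a \<in> cells 2 m" "b \<in> cells 2 m"
  shows "P a = P b"
proof -
  have m3: "m \<ge> 3"
    using m mod_less_eq_dividend[of m 8] by (auto simp: cong_def)
  define Q where "Q x = P (0, nat (x mod (2 * int m)))" for x
  let ?M = "2 * int m" and ?t = "int m + 4"
  have periodic: "Q x = Q y" if "[x = y] (mod ?M)" for x y
    using that by (simp add: Q_def cong_def)
  note cyc = two_rows_cyclic[where P = P, OF m3 inv, folded Q_def]
  have "\<exists>e. \<forall>x. Q x = Q e"
    using m
  proof
    assume "[m = 3] (mod 8)"
    then have "m = 8 * (m div 8) + 3"
      using mult_div_mod_eq[of 8 m] by (simp add: cong_def)
    then obtain h where h: "m = 8 * h + 3" by blast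
    \<comment> \<open>This \<open>l\<close> inverts \<open>m + 4\<close> modulo
      \<open>2 * m\<close>, so jumps of \<open>l\<close> positions from \<open>e = m\<close> visit
      \<open>m + 1\<close>, \<open>m + 2\<close>, \<open>m + 3\<close> in turn.\<close>
    define l where "l = 2 * int h + 1"
    have lt: "l * ?t = (int h + 1) * ?M + 1" by (simp add: h l_def algebra_simps)
    have E: "[int m + k * l * ?t = int m + k] (mod ?M)" for k
    proof -
      have "int m + k * l * ?t - (int m + k) = ?M * (k * (int h + 1))"
        using arg_cong[OF lt, of "\<lambda>z. k * z"] by (simp add: algebra_simps)
      then show ?thesis by (simp add: cong_iff_dvd_diff)
    qed
    have E': "[y = int m + k * l * ?t] (mod ?M) \<longleftrightarrow> [y = int m + k] (mod ?M)" for y k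
      using E[of k] by (simp only: cong_def)
    have Q_E: "Q (int m + k * l * ?t - d) = Q (int m + k - d)" for k d
      using E by (intro periodic cong_diff) auto
    have "?t * l - 1 = ?M * (int h + 1)" using lt by (simp add: algebra_simps)
    then have "[?t * l = 1] (mod ?M)" by (simp add: cong_iff_dvd_diff)
    then have coprime: "coprime ?t ?M" unfolding coprime_iff_invertible_int by blast
    have "Q x = Q (int m)" for x
    proof (rule swapped_progression[where Q = Q, OF periodic coprime])
      show "Q (y - ?t) = Q y"
        if "\<not> [y = int m] (mod ?M)" "\<not> [y = int m + l * ?t] (mod ?M)"
          "\<not> [y = int m + 2 * l * ?t] (mod ?M)" "\<not> [y = int m + 3 * l * ?t] (mod ?M)" for y
        using that E'[of y 1] E'[of y 2] E'[of y 3] cyc(1)[of y] by simp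
      show "0 < l" "3 * l < ?M" by (simp_all add: l_def h)
    qed (use Q_E[of 1 0] Q_E[of 1 ?t] Q_E[of 2 0] Q_E[of 2 ?t] Q_E[of 3 0] Q_E[of 3 ?t] cyc(2-5)
        in simp_all)
    then show ?thesis by blast
  next
    assume "[m = 5] (mod 8)"
    then have "m = 8 * (m div 8) + 5"
      using mult_div_mod_eq[of 8 m] by (simp add: cong_def)
    then obtain h where h: "m = 8 * h + 5" by blast
    \<comment> \<open>Here \<open>l\<close> is minus the inverse, so the jumps descend. Starting at
      \<open>e = m + 3\<close> again puts the swapped residues two jumps apart.\<close>
    define l where "l = 2 * int h + 1"
    have lt: "l * ?t = (int h + 1) * ?M - 1" by (simp add: h l_def algebra_simps)
    have E: "[int m + 3 + k * l * ?t = int m + (3 - k)] (mod ?M)" for k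
    proof -
      have "int m + 3 + k * l * ?t - (int m + (3 - k)) = ?M * (k * (int h + 1))"
        using arg_cong[OF lt, of "\<lambda>z. k * z"] by (simp add: algebra_simps)
      then show ?thesis by (simp add: cong_iff_dvd_diff)
    qed
    have E': "[y = int m + 3 + k * l * ?t] (mod ?M) \<longleftrightarrow> [y = int m + (3 - k)] (mod ?M)" for y k
      using E[of k] by (simp only: cong_def)
    have Q_E: "Q (int m + 3 + k * l * ?t - d) = Q (int m + (3 - k) - d)" for k d
      using E by (intro periodic cong_diff) auto
    have "?t * (- l) - 1 = ?M * (- (int h + 1))" using lt by (simp add: algebra_simps)
    then have "[?t * (- l) = 1] (mod ?M)" unfolding cong_iff_dvd_diff by (rule dvdI)
    then have coprime: "coprime ?t ?M" unfolding coprime_iff_invertible_int by blast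
    have "Q x = Q (int m + 3)" for x
    proof (rule swapped_progression[where Q = Q, OF periodic coprime])
      show "Q (y - ?t) = Q y"
        if "\<not> [y = int m + 3] (mod ?M)" "\<not> [y = int m + 3 + l * ?t] (mod ?M)"
          "\<not> [y = int m + 3 + 2 * l * ?t] (mod ?M)" "\<not> [y = int m + 3 + 3 * l * ?t] (mod ?M)" for y
        using that E'[of y 1] E'[of y 2] E'[of y 3] cyc(1)[of y] by simp
      show "0 < l" "3 * l < ?M" by (simp_all add: l_def h)
    qed (use Q_E[of 1 0] Q_E[of 1 ?t] Q_E[of 2 0] Q_E[of 2 ?t] Q_E[of 3 0] Q_E[of 3 ?t] cyc(2-5)
        in simp_all)
    then show ?thesis by blast
  qed
  then obtain e where e: "\<And>x. Q x = Q e" by blast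
  have "P a = Q e" if "a \<in> cells 2 m" for a
  proof -
    obtain i c where ic: "a = (i, c)" "i < 4" "c < 2 * m"
      using \<open>a \<in> cells 2 m\<close> by (auto simp: cells_def)
    obtain c' where "c' < 2 * m" "P (i, c) = P (0, c')"
      using two_rows_return(6)[where P = P, OF m3 inv ic(2,3)] by blast
    moreover have "Q (int c') = P (0, c')"
      using \<open>c' < 2 * m\<close> by (simp add: Q_def flip: zmod_int)
    ultimately show ?thesis using e ic(1) by metis
  qed
  then show ?thesis using ab by simp
qed

theorem proposition16:
  fixes m :: nat
  assumes "m > 0"
    and "[m = 3] (mod 8) \<or> [m = 5] (mod 8)"
  shows "card (diagonals 2 m) = 1 \<and> \<not> (\<exists>p. hamiltonian_cycle (with_proj (grid_graph 2 m)) p)"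
proof -
  have single: "diagonals 2 m = {cells 2 m}"
    using two_rows_invariant_constant[OF assms(2)] assms(1)
    by (intro diagonals_eq_singleton) auto
  moreover have "m > 1"
    using assms(2) mod_less_eq_dividend[of m 8] by (auto simp: cong_def)
  ultimately show ?thesis
    using no_hamiltonian_cycle_if_single_diagonal[of 2 m] by simp
qed

end
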